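(* Let $P$ be a rooted forest with $n := |P|$ elements, naturally labeled by $[n]=\{1,\dots,n\}$, let $x_1,\dots,x_n$ be strictly positive real numbers with $x_1+\cdots+x_n=1$, and let $p_x := \min\{x_i \mid 1\le i\le n\}$. Consider the promotion Markov chain on the set $\mathcal{L}(P)$ of linear extensions of $P$ with parameters $x_1,\dots,x_n$, started from an arbitrary initial distribution. Let $\mathbb{P}^k$ be the distribution of the chain after $k$ steps and let $w$ be its stationary distribution. Then, as soon as $k \ge (n^2-1)/p_x$, the distance to stationarity satisfies $$\|\mathbb{P}^k - w\| \le \exp\left(-\frac{(k p_x-(n^2-1))^2}{2 k p_x}\right).$$
   Context: A rooted tree is a connected finite poset in which each element has at most one successor (i.e. is covered by at most one element); a rooted forest is a disjoint union of rooted trees. A poset $P$ of size $n$ with order $\preceq$ is naturally labeled if its elements are labeled by $[n]$ so that $i\preceq j$ in $P$ implies $i\le j$ as integers; elements are identified with their labels. The set of linear extensions is $\mathcal{L}(P)=\{\pi\in S_n \mid i\prec j \text{ in } P \Rightarrow \pi^{-1}_i<\pi^{-1}_j\}$, where $\pi=\pi_1\cdots\pi_n$ is written in one-line notation and $\pi^{-1}_i$ is the position of $i$ in $\pi$. For $1\le i<n$ the operator $\tau_i$ acts on the right on $\mathcal{L}(P)$: $\pi\tau_i$ is obtained from $\pi$ by swapping the entries $\pi_i$ and $\pi_{i+1}$ if these are incomparable in $P$, and $\pi\tau_i=\pi$ otherwise. For $1\le j\le n$ the extended promotion operator is $\partial_j=\tau_j\tau_{j+1}\cdots\tau_{n-1}$,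 acting on the right (so $\tau_j$ is applied first); $\partial_n$ is the identity. The promotion Markov chain (the chain of the promotion graph) is the discrete-time Markov chain on $\mathcal{L}(P)$ which, from state $\pi$, for each $j\in[n]$ moves to $\pi\partial_j$ with probability $x_{\pi_j}$ (probabilities of different $j$ leading to the same state are added). For strictly positive $x_i$ this chain is irreducible and aperiodic, so it has a unique stationary probability distribution $w$. The norm is total variation distance: $\|\mathbb{P}^k-w\|=\frac12\sum_{\pi\in\mathcal{L}(P)}|\mathbb{P}^k(\pi)-w(\pi)|$. *)

theory Defs
  imports
    "HOL-Probability.Probability"
    "HOL-Combinatorics.Combinatorics"
    "HOL-Library.Disjoint_Sets"
begin

text \<open>A poset with carrier \<open>A\<close> is a relation \<open>r\<close> with \<open>partial_order_on A r\<close> (reflexive, and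
  contained in \<open>A \<times> A\<close>); \<open>(a, b) \<in> r\<close> means \<open>a \<preceq> b\<close>.\<close>

definition covers :: "'a rel \<Rightarrow> 'a \<Rightarrow> 'a \<Rightarrow> bool" where
  "covers r b a \<longleftrightarrow> (a, b) \<in> r \<and> a \<noteq> b \<and>
     \<not> (\<exists>c. (a, c) \<in> r \<and> (c, b) \<in> r \<and> c \<noteq> a \<and> c \<noteq> b)"

text \<open>Connected: any two elements are joined by a chain of comparabilities.\<close>

definition poset_connected :: "'a set \<Rightarrow> 'a rel \<Rightarrow> bool" where
  "poset_connected A r \<longleftrightarrow> (\<forall>a\<in>A. \<forall>b\<in>A. (a, b) \<in> (r \<union> r\<inverse>)\<^sup>*)"

definition rooted_tree :: "'a set \<Rightarrow> 'a rel \<Rightarrow> bool" where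
  "rooted_tree A r \<longleftrightarrow> partial_order_on A r \<and> finite A \<and> poset_connected A r \<and>
     (\<forall>a\<in>A. \<forall>b c. covers r b a \<and> covers r c a \<longrightarrow> b = c)"

text \<open>The equation for \<open>r\<close> says that elements of different blocks are incomparable,
  so that the poset is the disjoint union of its blocks.\<close>

definition rooted_forest :: "'a set \<Rightarrow> 'a rel \<Rightarrow> bool" where
  "rooted_forest A r \<longleftrightarrow> partial_order_on A r \<and> finite A \<and>
     (\<exists>Q. partition_on A Q \<and>
          (\<forall>B\<in>Q. rooted_tree B (r \<inter> B \<times> B)) \<and>
          r = (\<Union>B\<in>Q. r \<inter> B \<times> B))"

definition naturally_labeled :: "nat rel \<Rightarrow> bool" where
  "naturally_labeled r \<longleftrightarrow> (\<forall>i j. (i, j) \<in> r \<longrightarrow> i \<le> j)"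

text \<open>A permutation is given by its one-line notation: the \<open>i\<close>-th entry of \<open>\<pi>\<close> is \<open>\<pi> i\<close>,
  and \<open>inv \<pi> i\<close> is the position of the label \<open>i\<close>.\<close>

definition linear_extensions :: "nat \<Rightarrow> nat rel \<Rightarrow> (nat \<Rightarrow> nat) set" where
  "linear_extensions n r =
     {\<pi>. \<pi> permutes {1..n} \<and> (\<forall>i j. (i, j) \<in> r \<and> i \<noteq> j \<longrightarrow> inv \<pi> i < inv \<pi> j)}"

definition tau :: "nat rel \<Rightarrow> nat \<Rightarrow> (nat \<Rightarrow> nat) \<Rightarrow> (nat \<Rightarrow> nat)" where
  "tau r i \<pi> =
     (if (\<pi> i, \<pi> (i + 1)) \<notin> r \<and> (\<pi> (i + 1), \<pi> i) \<notin> r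
      then \<pi>(i := \<pi> (i + 1), i + 1 := \<pi> i)
      else \<pi>)"

text \<open>The operators act on the right, so \<open>tau r j\<close> is applied first and \<open>tau r (n - 1)\<close> last.\<close>

definition ext_promotion :: "nat \<Rightarrow> nat rel \<Rightarrow> nat \<Rightarrow> (nat \<Rightarrow> nat) \<Rightarrow> (nat \<Rightarrow> nat)" where
  "ext_promotion n r j = fold (tau r) [j..<n]"

text \<open>From \<open>\<pi>\<close>, a position \<open>j\<close> is drawn with probability \<open>x (\<pi> j)\<close>. The value of
  \<open>embed_pmf\<close> is meaningful because \<open>x\<close> is nonnegative on \<open>{1..n}\<close> with sum \<open>1\<close> there; see
  \<open>pmf_promotion_position\<close> and \<open>pmf_promotion_step\<close> below.\<close>

definition promotion_position :: "nat \<Rightarrow> (nat \<Rightarrow> real) \<Rightarrow> (nat \<Rightarrow> nat) \<Rightarrow> nat pmf" where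
  "promotion_position n x \<pi> = embed_pmf (\<lambda>j. if j \<in> {1..n} then x (\<pi> j) else 0)"

definition promotion_step ::
    "nat \<Rightarrow> nat rel \<Rightarrow> (nat \<Rightarrow> real) \<Rightarrow> (nat \<Rightarrow> nat) \<Rightarrow> (nat \<Rightarrow> nat) pmf" where
  "promotion_step n r x \<pi> =
     map_pmf (\<lambda>j. ext_promotion n r j \<pi>) (promotion_position n x \<pi>)"

definition chain_dist :: "('s \<Rightarrow> 's pmf) \<Rightarrow> 's pmf \<Rightarrow> nat \<Rightarrow> 's pmf" where
  "chain_dist K \<mu> k = ((\<lambda>\<nu>. bind_pmf \<nu> K) ^^ k) \<mu>"

definition stationary_dist :: "'s set \<Rightarrow> ('s \<Rightarrow> 's pmf) \<Rightarrow> 's pmf \<Rightarrow> bool" where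
  "stationary_dist S K w \<longleftrightarrow> set_pmf w \<subseteq> S \<and> bind_pmf w K = w"

definition tv_dist :: "'s set \<Rightarrow> 's pmf \<Rightarrow> 's pmf \<Rightarrow> real" where
  "tv_dist S p q = (1 / 2) * (\<Sum>s\<in>S. \<bar>pmf p s - pmf q s\<bar>)"

lemma pmf_promotion_position:
  assumes "\<And>i. i \<in> {1..n} \<Longrightarrow> 0 < x i" and "(\<Sum>i\<in>{1..n}. x i) = 1"
    and "\<pi> permutes {1..n}"
  shows "pmf (promotion_position n x \<pi>) j = (if j \<in> {1..n} then x (\<pi> j) else 0)"
proof -
  let ?f = "\<lambda>j. if j \<in> {1..n} then x (\<pi> j) else 0"
  have in_range: "\<pi> j \<in> {1..n}" if "j \<in> {1..n}" for j
    using that permutes_in_image[OF assms(3)] by blast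
  have nonneg: "0 \<le> ?f j" for j
    using assms(1) in_range by (auto intro: less_imp_le)
  have "(\<integral>\<^sup>+j. ennreal (?f j) \<partial>count_space UNIV)
      = (\<Sum>j\<in>{1..n}. ennreal (?f j))"
    by (subst nn_integral_count_space'[of "{1..n}"]) auto
  also have "\<dots> = ennreal (\<Sum>j\<in>{1..n}. ?f j)"
    using nonneg by (intro sum_ennreal) blast
  also have "(\<Sum>j\<in>{1..n}. ?f j) = (\<Sum>j\<in>{1..n}. x (\<pi> j))"
    by (intro sum.cong) auto
  also have "\<dots> = 1"
    using sum.permute[OF assms(3), of x] assms(2) by (simp add: comp_def)
  finally have "(\<integral>\<^sup>+j. ennreal (?f j) \<partial>count_space UNIV) = 1" by simp
  then show ?thesis
    unfolding promotion_position_def using nonneg by (intro pmf_embed_pmf) auto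
qed

lemma pmf_promotion_step:
  assumes "\<And>i. i \<in> {1..n} \<Longrightarrow> 0 < x i" and "(\<Sum>i\<in>{1..n}. x i) = 1"
    and "\<pi> permutes {1..n}"
  shows "pmf (promotion_step n r x \<pi>) \<sigma> =
    (\<Sum>j | j \<in> {1..n} \<and> ext_promotion n r j \<pi> = \<sigma>. x (\<pi> j))"
proof -
  have pos: "pmf (promotion_position n x \<pi>) j = (if j \<in> {1..n} then x (\<pi> j) else 0)" for j
    by (rule pmf_promotion_position) (use assms in auto)
  let ?J = "{j. j \<in> {1..n} \<and> ext_promotion n r j \<pi> = \<sigma>}"
  let ?p = "promotion_position n x \<pi>"
  have sub: "set_pmf ?p \<subseteq> {1..n}"
    by (force simp: set_pmf_iff pos simp del: atLeastAtMost_iff split: if_splits)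
  have "pmf (promotion_step n r x \<pi>) \<sigma>
      = measure ?p ((\<lambda>j. ext_promotion n r j \<pi>) -` {\<sigma>})"
    by (simp add: promotion_step_def pmf_map)
  also have "\<dots> = measure ?p ?J"
    using sub by (intro measure_eq_AE) (auto simp: AE_measure_pmf_iff)
  also have "\<dots> = (\<Sum>j\<in>?J. pmf ?p j)"
    by (intro measure_measure_pmf_finite) simp
  also have "\<dots> = (\<Sum>j\<in>?J. x (\<pi> j))"
    by (intro sum.cong) (auto simp: pos)
  finally show ?thesis .
qed

end

theory Submission
  imports Defs "HOL-Probability.Product_PMF"
begin

text \<open>The bound comes from a coupling. Instead of a position, draw a \<^emph>\<open>label\<close> \<open>i\<close> with
  probability \<open>x i\<close> and apply the promotion that starts at the current position of \<open>i\<close>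
  (\<open>promotion_step_by_label\<close>). The law of the label does not depend on the state, so
  copies of the chain with different starting points can be driven by the same random labels, and
  the distance after \<open>k\<close> steps is at most the probability that the first \<open>k\<close>
  labels do not bring all starting points together (\<open>tv_dist_random_maps\<close>).

  Promotion at \<open>i\<close> carries \<open>i\<close> to the right until it stands just before the first element
  above it, which is then carried on in its place, and so on up to a root, which goes to the end.
  Fix an up-set \<open>U\<close> and look only at the order in which the elements of \<open>U\<close> are listed.
  In a forest the elements above \<open>i\<close> form a chain. Hence that partial
  listing evolves autonomously: a label in \<open>U\<close> promotes it as usual, and a label outside
  \<open>U\<close> acts as its lowest ancestor in \<open>U\<close>, or not at all
  (\<open>filter_promote_label_visible\<close>, \<open>filter_promote_label_hidden\<close>). Copies whose listings of
  \<open>U\<close> agree therefore agree on \<open>U\<close> forever. If moreover \<open>i\<close> is a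
  maximal element outside \<open>U\<close>, promotion at \<open>i\<close> puts it just before its parent, a place
  determined by the listing of \<open>U\<close> alone, so that the copies agree on \<open>U\<close> with \<open>i\<close>
  added from then on (\<open>filter_promote_label_new\<close>).

  By natural labeling \<open>{c + 1..n}\<close> is an up-set, so all copies have merged as soon as the labels
  \<open>n, n - 1, \<dots>, 1\<close> have occurred in this order (\<open>fold_promotion_coalesces\<close>). Each
  awaited label comes with probability at least \<open>p\<close>, so after \<open>k\<close> steps this has failed
  with at most the probability that a binomial variable with parameters \<open>k\<close> and \<open>p\<close> is at
  most \<open>n - 1\<close>. Since \<open>n - 1 \<le> n\<^sup>2 - 1\<close>, the Chernoff bound for the lower tail gives the
  claim (\<open>prob_countdown_unfinished\<close>, \<open>chernoff_exponent\<close>).\<close>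

section \<open>Promotion of words\<close>

text \<open>The order-theoretic form of a forest: the elements above a given one form a chain.\<close>

definition upward_linear :: "'a rel \<Rightarrow> bool" where
  "upward_linear r \<longleftrightarrow> (\<forall>a b c. (a, b) \<in> r \<and> (a, c) \<in> r \<longrightarrow> (b, c) \<in> r \<or> (c, b) \<in> r)"

lemma upward_linearD:
  "upward_linear r \<Longrightarrow> (a, b) \<in> r \<Longrightarrow> (a, c) \<in> r \<Longrightarrow> (b, c) \<in> r \<or> (c, b) \<in> r"
  by (auto simp: upward_linear_def)

text \<open>No letter stands to the right of a letter above it. For a letter \<open>a\<close> with \<open>(a, a) \<in> r\<close> this
  includes that it occurs at most once.\<close>

abbreviation order_respecting :: "'a rel \<Rightarrow> 'a list \<Rightarrow> bool" where
  "order_respecting r \<equiv> sorted_wrt (\<lambda>a b. (b, a) \<notin> r)"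

text \<open>The letter \<open>a\<close> is in hand and travels along the word until it meets a comparable letter;
  there it is put down and that letter is picked up. In an order-respecting word the comparable
  letter is larger.\<close>

fun promote :: "'a rel \<Rightarrow> 'a \<Rightarrow> 'a list \<Rightarrow> 'a list" where
  "promote r a [] = [a]"
| "promote r a (b # w) =
     (if (a, b) \<in> r \<or> (b, a) \<in> r then a # promote r b w else b # promote r a w)"

fun promote_label :: "'a rel \<Rightarrow> 'a \<Rightarrow> 'a list \<Rightarrow> 'a list" where
  "promote_label r i [] = []"
| "promote_label r i (a # w) = (if a = i then promote r i w else a # promote_label r i w)"

text \<open>What promotion at a letter \<open>a\<close> looks like to an observer who sees only an up-set that does
  not contain \<open>a\<close>: nothing moves before the first letter above \<open>a\<close>, where an ordinary
  promotion sets in.\<close>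

fun promote_hidden :: "'a rel \<Rightarrow> 'a \<Rightarrow> 'a list \<Rightarrow> 'a list" where
  "promote_hidden r a [] = []"
| "promote_hidden r a (b # w) = (if (a, b) \<in> r then promote r b w else b # promote_hidden r a w)"

lemma set_promote [simp]: "set (promote r a w) = insert a (set w)"
  by (induction w arbitrary: a) auto

lemma order_respecting_promote:
  "order_respecting r (a # w) \<Longrightarrow> order_respecting r (promote r a w)"
  by (induction w arbitrary: a) auto

lemma set_promote_label [simp]: "set (promote_label r i w) = set w"
  by (induction w) auto

lemma order_respecting_promote_label:
  "order_respecting r w \<Longrightarrow> order_respecting r (promote_label r i w)"
  by (induction w) (auto intro: order_respecting_promote)

lemma promote_label_append:
  "i \<notin> set u \<Longrightarrow> promote_label r i (u @ i # w) = u @ promote r i w"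
  by (induction u) auto

text \<open>Once a letter of the up-set is in hand, every letter picked up later lies in the up-set too,
  and the letters outside are merely passed by.\<close>

lemma filter_promote_visible:
  assumes up: "\<And>a b. (a, b) \<in> r \<Longrightarrow> P a \<Longrightarrow> P b"
    and "P a" "order_respecting r (a # w)"
  shows "filter P (promote r a w) = promote r a (filter P w)"
  using assms(2,3) by (induction w arbitrary: a) (auto dest: up)

lemma promote_hidden_cong:
  "(\<And>c. c \<in> set w \<Longrightarrow> (a, c) \<in> r \<longleftrightarrow> (b, c) \<in> r) \<Longrightarrow>
     promote_hidden r a w = promote_hidden r b w"
  by (induction w) auto

text \<open>This is where the forest hypothesis enters. While only hidden letters have been picked up, the
  letter in hand may have changed from \<open>a\<close> to some \<open>b\<close> above \<open>a\<close>; as the elements above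
  \<open>a\<close> form a chain and the word respects the order, the remaining letters above \<open>b\<close> are exactly
  those above \<open>a\<close>, and so the observer cannot tell the difference.\<close>

lemma filter_promote_hidden:
  assumes up: "\<And>a b. (a, b) \<in> r \<Longrightarrow> P a \<Longrightarrow> P b"
    and tr: "trans r"
    and chain: "upward_linear r"
    and "\<not> P a" "order_respecting r (a # w)"
  shows "filter P (promote r a w) = promote_hidden r a (filter P w)"
  using assms(4,5)
proof (induction w arbitrary: a)
  case Nil
  then show ?case by simp
next
  case (Cons b w)
  show ?case
  proof (cases "(a, b) \<in> r")
    case True
    show ?thesis
    proof (cases "P b")
      case True
      have "filter P (promote r b w) = promote r b (filter P w)"
        by (rule filter_promote_visible) (use up True Cons.prems in auto)
      then show ?thesis
        using True \<open>(a, b) \<in> r\<close> Cons.prems by simp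
    next
      case False
      have "(a, c) \<in> r \<longleftrightarrow> (b, c) \<in> r" if "c \<in> set (filter P w)" for c
        using upward_linearD[OF chain \<open>(a, b) \<in> r\<close>, of c] transD[OF tr \<open>(a, b) \<in> r\<close>] Cons.prems that
        by auto
      then have "promote_hidden r a (filter P w) = promote_hidden r b (filter P w)"
        by (rule promote_hidden_cong)
      then show ?thesis
        using False \<open>(a, b) \<in> r\<close> Cons by simp
    qed
  next
    case False
    then show ?thesis
      using Cons by auto
  qed
qed

lemma filter_promote_label_visible:
  assumes up: "\<And>a b. (a, b) \<in> r \<Longrightarrow> P a \<Longrightarrow> P b"
    and "P i" "order_respecting r w"
  shows "filter P (promote_label r i w) = promote_label r i (filter P w)"
  using assms(2,3)
proof (induction w)
  case (Cons a w)
  then show ?case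
    using filter_promote_visible[where r = r and P = P and a = i and w = w] up by auto
qed simp

lemma filter_promote_label_hidden:
  assumes up: "\<And>a b. (a, b) \<in> r \<Longrightarrow> P a \<Longrightarrow> P b"
    and tr: "trans r"
    and chain: "upward_linear r"
    and "\<not> P i" "order_respecting r w" "i \<in> set w"
  shows "filter P (promote_label r i w) = promote_hidden r i (filter P w)"
  using assms(4-)
proof (induction w)
  case (Cons a w)
  show ?case
  proof (cases "a = i")
    case True
    then show ?thesis
      using Cons.prems filter_promote_hidden[where r = r and P = P and a = i and w = w] up tr chain by simp
  next
    case False
    then have "(i, a) \<notin> r" using Cons.prems by auto
    then show ?thesis using Cons False by auto
  qed
qed simp

text \<open>Every element above \<open>i\<close> other than \<open>i\<close> itself is visible. So the right-hand side mentions
  only the visible word, whatever the old position of \<open>i\<close> was: the visible letters to its left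
  are incomparable to it, and starting to carry \<open>i\<close> at the beginning of the word leaves them in place.\<close>

lemma filter_promote_label_new:
  assumes up: "\<And>a b. (a, b) \<in> r \<Longrightarrow> P a \<Longrightarrow> P b"
    and up_i: "\<And>b. (i, b) \<in> r \<Longrightarrow> b = i \<or> P b"
    and "\<not> P i" "(i, i) \<in> r" "order_respecting r w" "i \<in> set w"
  shows "filter (\<lambda>a. a = i \<or> P a) (promote_label r i w) = promote r i (filter P w)"
  using assms(3-)
proof (induction w)
  case (Cons a w)
  show ?case
  proof (cases "a = i")
    case True
    have "i \<notin> set w" using Cons.prems True by auto
    then have "filter (\<lambda>a. a = i \<or> P a) w = filter P w"
      by (intro filter_cong) auto
    moreover have "filter (\<lambda>a. a = i \<or> P a) (promote r i w)
        = promote r i (filter (\<lambda>a. a = i \<or> P a) w)"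
      by (rule filter_promote_visible) (use up up_i Cons.prems True in auto)
    ultimately show ?thesis using True Cons.prems by simp
  next
    case False
    then have "(i, a) \<notin> r" using Cons.prems by auto
    moreover have "(a, i) \<notin> r" if "P a" using up that Cons.prems by blast
    ultimately show ?thesis using Cons False by auto
  qed
qed simp

section \<open>Linear extensions as words\<close>

definition word :: "nat \<Rightarrow> (nat \<Rightarrow> nat) \<Rightarrow> nat list" where
  "word n \<pi> = map \<pi> [1..<Suc n]"

lemma set_word: "\<pi> permutes {1..n} \<Longrightarrow> set (word n \<pi>) = {1..n}"
  using permutes_image[of \<pi> "{1..n}"] by (simp add: word_def atLeastLessThanSuc_atLeastAtMost del: upt_Suc)

lemma word_inject:
  assumes "\<pi> permutes {1..n}" "\<sigma> permutes {1..n}" "word n \<pi> = word n \<sigma>"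
  shows "\<pi> = \<sigma>"
proof
  fix i
  show "\<pi> i = \<sigma> i"
  proof (cases "i \<in> {1..n}")
    case True
    then show ?thesis
      using assms(3) by (auto simp: word_def simp del: upt_Suc)
  next
    case False
    then show ?thesis
      using assms(1,2) by (simp add: permutes_not_in)
  qed
qed

lemma linear_extensions_iff:
  assumes r: "r \<subseteq> {1..n} \<times> {1..n}"
  shows "\<pi> \<in> linear_extensions n r \<longleftrightarrow> \<pi> permutes {1..n} \<and> order_respecting r (word n \<pi>)"
proof (cases "\<pi> permutes {1..n}")
  case True
  note inv = permutes_inverses[OF True]
  have sorted: "order_respecting r (word n \<pi>) \<longleftrightarrow>
      (\<forall>i j. 1 \<le> i \<and> i < j \<and> j \<le> n \<longrightarrow> (\<pi> j, \<pi> i) \<notin> r)" (is "_ \<longleftrightarrow> ?R")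
  proof
    assume *: "order_respecting r (word n \<pi>)"
    show ?R
    proof (intro allI impI)
      fix i j assume ij: "1 \<le> i \<and> i < j \<and> j \<le> n"
      then have "(word n \<pi> ! (j - 1), word n \<pi> ! (i - 1)) \<notin> r"
        by (intro sorted_wrt_nth_less[OF *]) (auto simp: word_def)
      moreover have "word n \<pi> ! (l - 1) = \<pi> l" if "1 \<le> l" "l \<le> n" for l
        using that by (simp add: word_def nth_map_upt del: upt_Suc)
      ultimately show "(\<pi> j, \<pi> i) \<notin> r"
        using ij by simp
    qed
  next
    assume ?R
    then show "order_respecting r (word n \<pi>)"
      by (auto simp: sorted_wrt_iff_nth_less word_def simp del: upt_Suc)
  qed
  have "?R \<longleftrightarrow> (\<forall>i j. (i, j) \<in> r \<and> i \<noteq> j \<longrightarrow> inv \<pi> i < inv \<pi> j)" (is "_ \<longleftrightarrow> ?L")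
  proof
    assume R: ?R
    show ?L
    proof (intro allI impI, rule ccontr)
      fix i j assume ij: "(i, j) \<in> r \<and> i \<noteq> j" and "\<not> inv \<pi> i < inv \<pi> j"
      moreover have "inv \<pi> i \<noteq> inv \<pi> j" using ij inv(1) by metis
      moreover have "inv \<pi> i \<in> {1..n}" "inv \<pi> j \<in> {1..n}"
        using ij r permutes_in_image[OF permutes_inv[OF True]] by blast+
      ultimately show False using R[rule_format, of "inv \<pi> j" "inv \<pi> i"] inv(1) by auto
    qed
  next
    assume L: ?L
    show ?R
    proof (intro allI impI notI)
      fix i j assume ij: "1 \<le> i \<and> i < j \<and> j \<le> n" and "(\<pi> j, \<pi> i) \<in> r"
      moreover have "\<pi> j \<noteq> \<pi> i" using ij inv(2) by (metis nat_neq_iff)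
      ultimately have "j < i" using L inv(2) by metis
      then show False using ij by simp
    qed
  qed
  then show ?thesis using True sorted by (auto simp: linear_extensions_def)
qed (simp add: linear_extensions_def)

lemma finite_linear_extensions: "finite (linear_extensions n r)"
  by (rule finite_subset[OF _ finite_permutations[of "{1..n}"]])
    (auto simp: linear_extensions_def)

lemma tau_permutes:
  assumes "\<pi> permutes {1..n}" "1 \<le> i" "i < n"
  shows "tau r i \<pi> permutes {1..n}"
proof -
  have "\<pi>(i := \<pi> (i + 1), i + 1 := \<pi> i) = \<pi> \<circ> Transposition.transpose i (i + 1)"
    by (auto simp: fun_eq_iff transpose_def)
  moreover have "\<pi> \<circ> Transposition.transpose i (i + 1) permutes {1..n}"
    using assms by (intro permutes_compose permutes_swap_id) auto
  ultimately show ?thesis using assms(1) by (simp add: tau_def)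
qed

lemma word_split:
  assumes "1 \<le> j" "j \<le> n"
  shows "word n \<pi> = map \<pi> [1..<j] @ \<pi> j # map \<pi> [Suc j..<Suc n]"
proof -
  have "[1..<Suc n] = [1..<j] @ j # [Suc j..<Suc n]"
    using assms upt_add_eq_append[of 1 j "Suc n - j"] upt_conv_Cons[of j "Suc n"] by simp
  then show ?thesis by (simp add: word_def del: upt_Suc)
qed

text \<open>The adjacent transpositions \<open>tau\<close> perform the promotion of the word one letter at a time:
  each step either moves the letter in hand by one place or changes hands.\<close>

lemma ext_promotion_word:
  assumes "1 \<le> j" "j \<le> n" "\<pi> permutes {1..n}"
  shows "ext_promotion n r j \<pi> permutes {1..n} \<and>
    word n (ext_promotion n r j \<pi>) = map \<pi> [1..<j] @ promote r (\<pi> j) (map \<pi> [Suc j..<Suc n])"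
  using assms(2,1,3)
proof (induction j arbitrary: \<pi> rule: inc_induct)
  case base
  then show ?case
    using word_split[of n n \<pi>] by (simp add: ext_promotion_def)
next
  case (step j)
  let ?\<pi> = "tau r j \<pi>"
  have rec: "ext_promotion n r j \<pi> = ext_promotion n r (Suc j) ?\<pi>"
    using step.hyps by (simp add: ext_promotion_def upt_conv_Cons)
  have perm: "?\<pi> permutes {1..n}"
    using step by (intro tau_permutes) auto
  note IH = step.IH[OF _ perm]
  have upt: "[Suc j..<Suc n] = Suc j # [Suc (Suc j)..<Suc n]"
    using step.hyps by (simp add: upt_conv_Cons del: upt_Suc)
  have low: "map ?\<pi> [1..<j] = map \<pi> [1..<j]" and
    high: "map ?\<pi> [Suc (Suc j)..<Suc n] = map \<pi> [Suc (Suc j)..<Suc n]"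
    by (auto simp: tau_def simp del: upt_Suc)
  have "map ?\<pi> [1..<Suc j] = map ?\<pi> [1..<j] @ [?\<pi> j]"
    using step.prems by simp
  then show ?case
    using IH unfolding rec upt low high by (auto simp: tau_def simp del: upt_Suc)
qed

section \<open>Driving the chain by labels\<close>

definition promotion_by_label :: "nat \<Rightarrow> nat rel \<Rightarrow> nat \<Rightarrow> (nat \<Rightarrow> nat) \<Rightarrow> (nat \<Rightarrow> nat)" where
  "promotion_by_label n r i \<pi> = ext_promotion n r (inv \<pi> i) \<pi>"

lemma promotion_by_label_word:
  assumes "\<pi> permutes {1..n}" "i \<in> {1..n}"
  shows "promotion_by_label n r i \<pi> permutes {1..n}"
    and "word n (promotion_by_label n r i \<pi>) = promote_label r i (word n \<pi>)"
proof -
  let ?j = "inv \<pi> i"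
  have j: "?j \<in> {1..n}"
    using assms permutes_in_image[OF permutes_inv[OF assms(1)]] by blast
  have \<pi>j: "\<pi> ?j = i" using assms(1) by (rule permutes_inverses)
  have "i \<notin> set (map \<pi> [1..<?j])"
    using permutes_inverses(2)[OF assms(1)] by auto
  then show "promotion_by_label n r i \<pi> permutes {1..n}"
    "word n (promotion_by_label n r i \<pi>) = promote_label r i (word n \<pi>)"
    using ext_promotion_word[of ?j n \<pi> r] j word_split[of ?j n \<pi>] assms(1)
    by (auto simp: promotion_by_label_def \<pi>j promote_label_append simp del: upt_Suc)
qed

text \<open>The distribution of the label \<open>\<pi> j\<close> at the drawn position \<open>j\<close> is given by \<open>x\<close>; it is
  represented as the position drawn from the identity permutation.\<close>

lemma promotion_step_by_label:
  assumes "\<And>i. i \<in> {1..n} \<Longrightarrow> 0 < x i" and "(\<Sum>i\<in>{1..n}. x i) = 1"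
    and "\<pi> permutes {1..n}"
  shows "promotion_step n r x \<pi> =
    map_pmf (\<lambda>i. promotion_by_label n r i \<pi>) (promotion_position n x id)"
proof -
  have "promotion_position n x \<pi> = map_pmf (inv \<pi>) (promotion_position n x id)"
  proof (rule pmf_eqI)
    fix j
    have "inj (inv \<pi>)" using permutes_inj[OF permutes_inv[OF assms(3)]] .
    then have "pmf (map_pmf (inv \<pi>) (promotion_position n x id)) (inv \<pi> (\<pi> j))
        = pmf (promotion_position n x id) (\<pi> j)"
      by (rule pmf_map_inj')
    moreover have "inv \<pi> (\<pi> j) = j" using assms(3) by (rule permutes_inverses)
    moreover have "\<pi> j \<in> {1..n} \<longleftrightarrow> j \<in> {1..n}" using assms(3) by (rule permutes_in_image)
    moreover have "pmf (promotion_position n x \<pi>) j = (if j \<in> {1..n} then x (\<pi> j) else 0)"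
      by (rule pmf_promotion_position) (use assms in auto)
    moreover have "pmf (promotion_position n x id) (\<pi> j) = (if \<pi> j \<in> {1..n} then x (\<pi> j) else 0)"
      using pmf_promotion_position[of n x id "\<pi> j"] assms permutes_id by auto
    ultimately show "pmf (promotion_position n x \<pi>) j
        = pmf (map_pmf (inv \<pi>) (promotion_position n x id)) j" by simp
  qed
  then show ?thesis
    by (simp add: promotion_step_def promotion_by_label_def pmf.map_comp comp_def)
qed

text \<open>The first letter of the list is applied first, so prepending a label corresponds to a step
  taken before all others; the induction therefore replaces the initial distribution.\<close>

lemma chain_dist_random_maps:
  assumes "\<And>s. s \<in> S \<Longrightarrow> K s = map_pmf (\<lambda>i. F i s) X"
    and "\<And>s i. s \<in> S \<Longrightarrow> i \<in> set_pmf X \<Longrightarrow> F i s \<in> S"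
    and "set_pmf \<mu> \<subseteq> S"
  shows "chain_dist K \<mu> k = bind_pmf (replicate_pmf k X) (\<lambda>is. map_pmf (fold F is) \<mu>)"
  using assms(3)
proof (induction k arbitrary: \<mu>)
  case 0
  then show ?case by (simp add: chain_dist_def bind_return_pmf)
next
  case (Suc k)
  have step: "bind_pmf \<mu> K = bind_pmf \<mu> (\<lambda>s. map_pmf (\<lambda>i. F i s) X)"
    by (rule bind_pmf_cong) (use Suc.prems assms(1) in auto)
  have "set_pmf (bind_pmf \<mu> K) \<subseteq> S"
    unfolding step using Suc.prems assms(2) by (auto simp: set_bind_pmf)
  then have "chain_dist K \<mu> (Suc k)
      = bind_pmf (replicate_pmf k X) (\<lambda>is. map_pmf (fold F is) (bind_pmf \<mu> K))"
    using Suc.IH by (simp add: chain_dist_def funpow_swap1 del: funpow.simps add: funpow_Suc_right)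
  also have "\<dots> = bind_pmf (replicate_pmf k X) (\<lambda>is. bind_pmf X (\<lambda>i. map_pmf (fold F (i # is)) \<mu>))"
    unfolding step map_bind_pmf map_pmf_comp
    by (simp add: map_pmf_def bind_assoc_pmf bind_return_pmf bind_commute_pmf[of \<mu> X])
  also have "\<dots> = bind_pmf (replicate_pmf (Suc k) X) (\<lambda>is. map_pmf (fold F is) \<mu>)"
    by (simp add: bind_assoc_pmf bind_return_pmf bind_commute_pmf[of X "replicate_pmf k X"])
  finally show ?case .
qed

lemma chain_dist_stationary: "stationary_dist S K w \<Longrightarrow> chain_dist K w k = w"
  by (induction k) (auto simp: stationary_dist_def chain_dist_def)

text \<open>Outside the event that the two variables differ, they contribute equally to both masses at
  each point, so that event alone accounts for the difference.\<close>

lemma tv_dist_coupling: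
  assumes "finite S"
  shows "tv_dist S (map_pmf f C) (map_pmf g C) \<le> measure_pmf.prob C {c. f c \<noteq> g c}"
proof -
  let ?D = "{c. f c \<noteq> g c}"
  let ?P = "measure_pmf.prob C"
  have bound: "(\<Sum>s\<in>S. ?P {c \<in> ?D. h c = s}) \<le> ?P ?D" for h :: "'b \<Rightarrow> 'a"
  proof -
    have "(\<Sum>s\<in>S. ?P {c \<in> ?D. h c = s}) = ?P (\<Union>s\<in>S. {c \<in> ?D. h c = s})"
      using assms by (intro measure_pmf.finite_measure_finite_Union[symmetric])
        (auto simp: disjoint_family_on_def)
    also have "\<dots> \<le> ?P ?D" by (intro measure_pmf.finite_measure_mono) auto
    finally show ?thesis .
  qed
  have split: "?P {c. h c = s} = ?P {c \<in> ?D. h c = s} + ?P {c. f c = s \<and> g c = s}"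
    if "h = f \<or> h = g" for h s
  proof -
    have "{c. h c = s} = {c \<in> ?D. h c = s} \<union> {c. f c = s \<and> g c = s}" using that by auto
    then show ?thesis
      by (simp, intro measure_pmf.finite_measure_Union) auto
  qed
  have "\<bar>pmf (map_pmf f C) s - pmf (map_pmf g C) s\<bar>
      \<le> ?P {c \<in> ?D. f c = s} + ?P {c \<in> ?D. g c = s}" for s
    using split[of f s] split[of g s] by (simp add: pmf_map vimage_def abs_le_iff)
  then have "(\<Sum>s\<in>S. \<bar>pmf (map_pmf f C) s - pmf (map_pmf g C) s\<bar>)
      \<le> (\<Sum>s\<in>S. ?P {c \<in> ?D. f c = s}) + (\<Sum>s\<in>S. ?P {c \<in> ?D. g c = s})"
    unfolding sum.distrib[symmetric] by (rule sum_mono)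
  also have "\<dots> \<le> 2 * ?P ?D" using bound[of f] bound[of g] by simp
  finally show ?thesis by (simp add: tv_dist_def)
qed

text \<open>Apply the same random map to independent starting points with laws \<open>\<mu>\<close> and \<open>\<nu>\<close>.\<close>

lemma tv_dist_random_maps:
  assumes "finite S"
    and "\<And>a s t. a \<in> set_pmf R \<Longrightarrow> a \<notin> B \<Longrightarrow> s \<in> set_pmf \<mu> \<Longrightarrow> t \<in> set_pmf \<nu> \<Longrightarrow> f a s = f a t"
  shows "tv_dist S (bind_pmf R (\<lambda>a. map_pmf (f a) \<mu>)) (bind_pmf R (\<lambda>a. map_pmf (f a) \<nu>))
    \<le> measure_pmf.prob R B"
proof -
  let ?C = "pair_pmf R (pair_pmf \<mu> \<nu>)"
  let ?f = "\<lambda>(a, s, t). f a s" and ?g = "\<lambda>(a, s, t). f a t"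
  have marg: "bind_pmf R (\<lambda>a. map_pmf (f a) \<mu>) = map_pmf ?f ?C"
    "bind_pmf R (\<lambda>a. map_pmf (f a) \<nu>) = map_pmf ?g ?C"
    by (simp_all add: pair_pmf_def map_pmf_def bind_assoc_pmf bind_return_pmf)
  have "measure_pmf.prob ?C {c. ?f c \<noteq> ?g c} \<le> measure_pmf.prob ?C (fst -` B)"
  proof (rule measure_pmf.finite_measure_mono_AE)
    show "AE c in measure_pmf ?C. c \<in> {c. ?f c \<noteq> ?g c} \<longrightarrow> c \<in> fst -` B"
      using assms(2) by (auto simp: AE_measure_pmf_iff)
  qed simp
  also have "\<dots> = measure_pmf.prob (map_pmf fst ?C) B"
    by (simp only: measure_map_pmf)
  also have "map_pmf fst ?C = R" by (rule map_fst_pair_pmf)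
  finally show ?thesis
    unfolding marg using tv_dist_coupling[OF assms(1), of ?f ?C ?g] by linarith
qed

section \<open>Coalescence\<close>

text \<open>The labels above the counter are those on which all copies agree, and the counter itself is the
  label awaited next.\<close>

definition countdown :: "nat \<Rightarrow> nat \<Rightarrow> nat" where
  "countdown i c = (if i = c then c - 1 else c)"

definition agree_above :: "nat \<Rightarrow> nat \<Rightarrow> (nat \<Rightarrow> nat) \<Rightarrow> (nat \<Rightarrow> nat) \<Rightarrow> bool" where
  "agree_above n c \<pi> \<sigma> \<longleftrightarrow> filter ((<) c) (word n \<pi>) = filter ((<) c) (word n \<sigma>)"

lemma promotion_by_label_linear_extensions:
  assumes r: "r \<subseteq> {1..n} \<times> {1..n}"
    and "\<pi> \<in> linear_extensions n r" "i \<in> {1..n}"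
  shows "promotion_by_label n r i \<pi> \<in> linear_extensions n r"
  using assms promotion_by_label_word[of \<pi> n i r]
  by (simp add: linear_extensions_iff[OF r] order_respecting_promote_label)

text \<open>The listing of the labels above the new counter is a function of the listing of those above
  the old one, in each of the three positions of \<open>i\<close> relative to the counter.\<close>

lemma promotion_by_label_agree_above:
  assumes po: "partial_order_on {1..n} r" and labeled: "naturally_labeled r"
    and chain: "upward_linear r"
    and L: "\<pi> \<in> linear_extensions n r" "\<sigma> \<in> linear_extensions n r" and i: "i \<in> {1..n}"
    and agree: "agree_above n c \<pi> \<sigma>"
  shows "agree_above n (countdown i c)
    (promotion_by_label n r i \<pi>) (promotion_by_label n r i \<sigma>)"
proof -
  have le: "a \<le> b" if "(a, b) \<in> r" for a b
    using labeled that by (auto simp: naturally_labeled_def)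
  then have up: "c < b" if "(a, b) \<in> r" "c < a" for a b
    using that by fastforce
  have tr: "trans r" and refl: "(i, i) \<in> r"
    using partial_order_onD[OF po] i by (auto simp: refl_on_def)
  (* Promotion at i as seen on the labels above the counter. *)
  define autonomous where "autonomous =
    (if c < i then promote_label r i else if i < c then promote_hidden r i else promote r i)"
  have "filter ((<) (countdown i c)) (word n (promotion_by_label n r i \<rho>))
      = autonomous (filter ((<) c) (word n \<rho>))"
    if "\<rho> \<in> linear_extensions n r" for \<rho>
  proof -
    have \<rho>: "\<rho> permutes {1..n}" "order_respecting r (word n \<rho>)"
      using that linear_extensions_iff[OF partial_order_onD(4)[OF po]] by auto
    have mem: "i \<in> set (word n \<rho>)" using set_word[OF \<rho>(1)] i by simp
    consider "c < i" | "i < c" | "i = c" by linarith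
    then have "filter ((<) (countdown i c)) (promote_label r i (word n \<rho>))
        = autonomous (filter ((<) c) (word n \<rho>))"
    proof cases
      case 1
      then show ?thesis
        using filter_promote_label_visible[where r = r and P = "(<) c" and i = i and w = "word n \<rho>"] up \<rho>
        by (simp add: autonomous_def countdown_def)
    next
      case 2
      then show ?thesis
        using filter_promote_label_hidden[where r = r and P = "(<) c" and i = i and w = "word n \<rho>"] up tr chain \<rho> mem
        by (simp add: autonomous_def countdown_def)
    next
      case 3
      have "filter (\<lambda>a. a = i \<or> c < a) (promote_label r i (word n \<rho>))
          = promote r i (filter ((<) c) (word n \<rho>))"
      proof (rule filter_promote_label_new)
        show "b = i \<or> c < b" if "(i, b) \<in> r" for b
          using le[OF that] 3 by auto
      qed (use up refl \<rho> mem 3 in auto)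
      moreover have "(<) (c - 1) = (\<lambda>a. a = i \<or> c < a)"
        using 3 i by auto
      ultimately show ?thesis
        using 3 by (simp add: autonomous_def countdown_def)
    qed
    then show ?thesis using promotion_by_label_word[OF \<rho>(1) i] by simp
  qed
  then show ?thesis using L agree by (simp add: agree_above_def)
qed

lemma fold_promotion_agree_above:
  assumes po: "partial_order_on {1..n} r" and labeled: "naturally_labeled r"
    and chain: "upward_linear r"
    and "\<pi> \<in> linear_extensions n r" "\<sigma> \<in> linear_extensions n r" "set is \<subseteq> {1..n}"
    and "agree_above n c \<pi> \<sigma>"
  defines "F \<equiv> fold (promotion_by_label n r) is"
  shows "F \<pi> \<in> linear_extensions n r" "F \<sigma> \<in> linear_extensions n r"
    "agree_above n (fold countdown is c) (F \<pi>) (F \<sigma>)"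
proof -
  note stay = promotion_by_label_linear_extensions[OF partial_order_onD(4)[OF po]]
  have "F \<pi> \<in> linear_extensions n r \<and> F \<sigma> \<in> linear_extensions n r \<and>
      agree_above n (fold countdown is c) (F \<pi>) (F \<sigma>)"
    using assms(4-7) unfolding F_def
  proof (induction "is" arbitrary: \<pi> \<sigma> c)
    case (Cons i "is")
    then show ?case
      using stay[of \<pi> i] stay[of \<sigma> i]
        promotion_by_label_agree_above[where \<pi> = \<pi> and \<sigma> = \<sigma> and i = i and c = c, OF po labeled chain]
      by simp
  qed simp
  then show "F \<pi> \<in> linear_extensions n r" "F \<sigma> \<in> linear_extensions n r"
    "agree_above n (fold countdown is c) (F \<pi>) (F \<sigma>)" by auto
qed

text \<open>The counter starts at \<open>n\<close>, where agreement is vacuous, and at \<open>0\<close> agreement is equality.\<close>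

lemma fold_promotion_coalesces:
  assumes po: "partial_order_on {1..n} r" and labeled: "naturally_labeled r"
    and chain: "upward_linear r"
    and L: "\<pi> \<in> linear_extensions n r" "\<sigma> \<in> linear_extensions n r" and "is": "set is \<subseteq> {1..n}"
    and finished: "fold countdown is n = 0"
  shows "fold (promotion_by_label n r) is \<pi> = fold (promotion_by_label n r) is \<sigma>"
proof -
  note iff = linear_extensions_iff[OF partial_order_onD(4)[OF po]]
  have none: "filter ((<) n) (word n \<rho>) = []" if "\<rho> \<in> linear_extensions n r" for \<rho>
    using that set_word[of \<rho> n] by (auto simp: iff filter_empty_conv)
  have all: "filter ((<) 0) (word n \<rho>) = word n \<rho>" if "\<rho> \<in> linear_extensions n r" for \<rho>
    using that set_word[of \<rho> n] by (auto simp: iff filter_id_conv)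
  have "agree_above n n \<pi> \<sigma>" using none L by (simp add: agree_above_def)
  note fold_promotion_agree_above[OF po labeled chain L "is" this]
  then show ?thesis
    using all finished by (intro word_inject[of _ n]) (simp_all add: iff agree_above_def)
qed

section \<open>Trees have linearly ordered up-sets\<close>

text \<open>Two elements strictly above \<open>a\<close> lie above the same cover of \<open>a\<close>, to which the argument can
  be applied again. Natural labeling supplies the covers (as least labels) and the termination
  (labels increase).\<close>

lemma upper_bounds_comparable:
  fixes r :: "nat rel"
  assumes po: "partial_order_on {1..n} r" and labeled: "naturally_labeled r"
    and unique: "\<And>a b c. covers r b a \<Longrightarrow> covers r c a \<Longrightarrow> b = c"
    and "(a, b) \<in> r" "(a, c) \<in> r"
  shows "(b, c) \<in> r \<or> (c, b) \<in> r"
  using assms(4,5)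
proof (induction "n - a" arbitrary: a rule: less_induct)
  case less
  have tr: "trans r" and sub: "r \<subseteq> {1..n} \<times> {1..n}"
    using partial_order_onD[OF po] by auto
  have le: "i \<le> j" if "(i, j) \<in> r" for i j
    using labeled that by (auto simp: naturally_labeled_def)
  have cover: "\<exists>a'. covers r a' a \<and> (a', d) \<in> r" if "(a, d) \<in> r" "a \<noteq> d" for d
  proof -
    (* Anything strictly between a and the least such z would have a smaller label than z. *)
    define Q where "Q z \<longleftrightarrow> (a, z) \<in> r \<and> a \<noteq> z \<and> (z, d) \<in> r" for z
    have "(d, d) \<in> r" using partial_order_onD(1)[OF po] sub that by (auto simp: refl_on_def)
    then have "Q d" using that by (simp add: Q_def)
    define z where "z = (LEAST z. Q z)"
    have "Q z" unfolding z_def using \<open>Q d\<close> by (rule LeastI)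
    then have z: "(a, z) \<in> r" "a \<noteq> z" "(z, d) \<in> r" by (auto simp: Q_def)
    have "\<not> ((a, e) \<in> r \<and> (e, z) \<in> r \<and> e \<noteq> a \<and> e \<noteq> z)" for e
    proof
      assume e: "(a, e) \<in> r \<and> (e, z) \<in> r \<and> e \<noteq> a \<and> e \<noteq> z"
      then have "(e, d) \<in> r" using z(3) transD[OF tr] by blast
      then have "Q e" using e by (simp add: Q_def)
      then have "z \<le> e" unfolding z_def by (rule Least_le)
      then show False using le[of e z] e by simp
    qed
    then have "covers r z a" using z unfolding covers_def by blast
    then show ?thesis using z(3) by blast
  qed
  show ?case
  proof (cases "a = b \<or> a = c")
    case True
    then show ?thesis using less.prems by auto
  next
    case False
    then obtain a' a'' where a': "covers r a' a" "(a', b) \<in> r"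
      and a'': "covers r a'' a" "(a'', c) \<in> r"
      using cover[of b] cover[of c] less.prems by blast
    have "a'' = a'" using a''(1) a'(1) by (rule unique)
    have "(a, a') \<in> r" "a \<noteq> a'" using a'(1) unfolding covers_def by blast+
    then have "n - a' < n - a" using le[of a a'] sub by fastforce
    then show ?thesis using a'(2) a''(2) unfolding \<open>a'' = a'\<close> by (rule less.hyps)
  qed
qed

text \<open>All elements comparable to \<open>a\<close> lie in the block of \<open>a\<close>, so a cover in the forest is a cover
  in its tree.\<close>

lemma rooted_forest_unique_cover:
  assumes "rooted_forest A r" "covers r b a" "covers r c a"
  shows "b = c"
proof -
  obtain Q where part: "partition_on A Q"
    and tree: "\<And>B. B \<in> Q \<Longrightarrow> rooted_tree B (r \<inter> B \<times> B)" and r: "r = (\<Union>B\<in>Q. r \<inter> B \<times> B)"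
    using assms(1) unfolding rooted_forest_def by blast
  have block: "\<exists>B\<in>Q. a \<in> B \<and> d \<in> B" if "covers r d a" for d
  proof -
    have "(a, d) \<in> r" using that unfolding covers_def by blast
    then have "(a, d) \<in> (\<Union>B\<in>Q. r \<inter> B \<times> B)" by (subst (asm) r)
    then show ?thesis by blast
  qed
  obtain B C where B: "B \<in> Q" "a \<in> B" "b \<in> B" and C: "C \<in> Q" "a \<in> C" "c \<in> C"
    using block[OF assms(2)] block[OF assms(3)] by blast
  have "B = C"
    using partition_onD2[OF part] B C unfolding disjoint_def by blast
  then have "covers (r \<inter> B \<times> B) b a" "covers (r \<inter> B \<times> B) c a"
    using assms(2,3) B C unfolding covers_def by blast+
  then show ?thesis using tree[OF B(1)] B(2) unfolding rooted_tree_def by blast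
qed

section \<open>The coalescence time\<close>

lemma fold_countdown_0: "fold countdown is 0 = 0"
  by (induction "is") (auto simp: countdown_def)

text \<open>An exponential supermartingale: with \<open>\<rho> = 1 - p * (1 - exp (- t))\<close>, the potential
  \<open>exp (t * (c - 1))\<close> of a positive counter shrinks in expectation by a factor of at most
  \<open>\<rho>\<close> in each step, because the counter drops with probability at least \<open>p\<close>. The potential of
  an unfinished countdown is at least \<open>1\<close>, which bounds the probability.\<close>

lemma prob_countdown_unfinished:
  fixes X :: "nat pmf" and t p :: real
  assumes X: "\<And>i. i \<in> {1..n} \<Longrightarrow> p \<le> pmf X i" and "0 \<le> t" "c \<in> {1..n}"
  shows "measure_pmf.prob (replicate_pmf k X) {is. fold countdown is c \<noteq> 0}
    \<le> exp (t * (real c - 1)) * (1 - p * (1 - exp (- t))) ^ k"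
  using assms(3)
proof (induction k arbitrary: c)
  case 0
  have "0 \<le> t * (real c - 1)" using 0 assms(2) by simp
  then show ?case
    by (intro order.trans[OF measure_pmf.prob_le_1]) simp
next
  case (Suc k)
  let ?N = "\<lambda>c. {is. fold countdown is c \<noteq> 0}"
  let ?f = "\<lambda>c. measure_pmf.prob (replicate_pmf k X) (?N c)"
  let ?P = "pair_pmf X (replicate_pmf k X)"
  let ?q = "pmf X c"
  define \<rho> where "\<rho> = 1 - p * (1 - exp (- t))"
  have s: "0 \<le> 1 - exp (- t)" using assms(2) by simp
  have q: "p \<le> ?q" "?q \<le> 1" using X Suc.prems by (auto simp: pmf_le_1)
  have qs: "p * (1 - exp (- t)) \<le> ?q * (1 - exp (- t))" "?q * (1 - exp (- t)) \<le> 1 * 1"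
    using q s by (intro mult_right_mono mult_mono; simp)+
  have \<rho>: "0 \<le> \<rho>" using qs by (simp add: \<rho>_def)
  (* For c = 1 the countdown is finished after the drop, and the left-hand side is 0. *)
  have pred: "?f (c - 1) \<le> exp (t * (real c - 1)) * exp (- t) * \<rho> ^ k"
  proof (cases "c = 1")
    case True
    then show ?thesis using \<rho> by (simp add: fold_countdown_0)
  next
    case False
    then have "exp (t * (real (c - 1) - 1)) = exp (t * (real c - 1)) * exp (- t)"
      using Suc.prems by (simp add: exp_add[symmetric] algebra_simps of_nat_diff)
    moreover have "c - 1 \<in> {1..n}" using Suc.prems False by auto
    ultimately show ?thesis using Suc.IH[of "c - 1"] by (simp add: \<rho>_def)
  qed
  have stay: "?f c \<le> exp (t * (real c - 1)) * \<rho> ^ k"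
    using Suc.IH Suc.prems by (simp add: \<rho>_def)
  have "replicate_pmf (Suc k) X = map_pmf (\<lambda>(i, is). i # is) ?P"
    by (simp add: pair_pmf_def map_pmf_def bind_assoc_pmf bind_return_pmf)
  then have "measure_pmf.prob (replicate_pmf (Suc k) X) (?N c)
      = measure_pmf.prob ?P ({c} \<times> ?N (c - 1) \<union> (- {c}) \<times> ?N c)"
    by (simp only: measure_map_pmf) (rule arg_cong[where f = "measure_pmf.prob ?P"],
        auto simp: countdown_def split: if_splits)
  also have "\<dots> \<le> measure_pmf.prob ?P ({c} \<times> ?N (c - 1)) + measure_pmf.prob ?P ((- {c}) \<times> ?N c)"
    by (rule measure_Un_le) auto
  also have "\<dots> = ?q * ?f (c - 1) + (1 - ?q) * ?f c"
  proof -
    have "measure_pmf.prob X (- {c}) = 1 - ?q"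
      using measure_pmf.prob_compl[of "{c}" X]
      by (simp add: Compl_eq_Diff_UNIV measure_pmf_single)
    then show ?thesis
      by (simp add: measure_pmf_prob_product measure_pmf_single)
  qed
  also have "\<dots> \<le> ?q * (exp (t * (real c - 1)) * exp (- t) * \<rho> ^ k)
      + (1 - ?q) * (exp (t * (real c - 1)) * \<rho> ^ k)"
    using pred stay q by (intro add_mono mult_left_mono) auto
  also have "\<dots> = exp (t * (real c - 1)) * \<rho> ^ k * (1 - ?q * (1 - exp (- t)))"
    by (simp add: algebra_simps)
  also have "\<dots> \<le> exp (t * (real c - 1)) * \<rho> ^ k * \<rho>"
    using qs \<rho> by (intro mult_left_mono) (auto simp: \<rho>_def)
  finally show ?case by (simp add: \<rho>_def mult_ac)
qed

text \<open>The product of the quadratic Taylor polynomials of \<open>exp t\<close> and \<open>exp (- t)\<close> is \<open>1 + t ^ 4 / 4\<close>.\<close>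

lemma exp_minus_le_quadratic:
  fixes t :: real
  assumes "0 \<le> t"
  shows "exp (- t) \<le> 1 - t + t\<^sup>2 / 2"
proof -
  let ?q = "1 - t + t\<^sup>2 / 2"
  have q: "0 \<le> ?q"
    using zero_le_power2[of "1 - t"] by (simp add: power2_eq_square algebra_simps)
  have "1 \<le> 1 + t ^ 4 / 4" by simp
  also have "\<dots> = (1 + t + t\<^sup>2 / 2) * ?q"
    by (simp add: power2_eq_square power4_eq_xxxx algebra_simps)
  also have "\<dots> \<le> exp t * ?q"
    using exp_lower_Taylor_quadratic[OF assms] q by (intro mult_right_mono)
  finally show ?thesis
    by (simp add: exp_minus field_simps)
qed

text \<open>After \<open>1 + y \<le> exp y\<close> and the quadratic bound on \<open>exp (- t)\<close>, the exponent is at most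
  \<open>t * M - k * p * (t - t\<^sup>2 / 2)\<close>. The value of \<open>t\<close> chosen here minimises this parabola. For
  \<open>k * p = 0\<close> both \<open>t\<close> and the bound's exponent are \<open>0\<close> by the convention on division by zero.\<close>

lemma chernoff_exponent:
  fixes p m M :: real
  assumes "0 \<le> p" "p \<le> 1" "m \<le> M" "M \<le> real k * p"
  defines "t \<equiv> (real k * p - M) / (real k * p)"
  shows "0 \<le> t"
    and "exp (t * m) * (1 - p * (1 - exp (- t))) ^ k
      \<le> exp (- ((real k * p - M)\<^sup>2 / (2 * real k * p)))"
proof -
  let ?u = "real k * p"
  show t: "0 \<le> t" using assms by (simp add: t_def)
  have "p * (1 - exp (- t)) \<le> 1 * 1" using assms t by (intro mult_mono) auto
  then have base: "0 \<le> 1 - p * (1 - exp (- t))" by simp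
  have "1 - p * (1 - exp (- t)) \<le> exp (- (p * (1 - exp (- t))))"
    using exp_ge_add_one_self[of "- (p * (1 - exp (- t)))"] by simp
  then have "(1 - p * (1 - exp (- t))) ^ k \<le> exp (- (p * (1 - exp (- t)))) ^ k"
    using base by (rule power_mono)
  also have "\<dots> = exp (- (?u * (1 - exp (- t))))"
    by (simp add: exp_of_nat_mult[symmetric] algebra_simps)
  finally have "exp (t * m) * (1 - p * (1 - exp (- t))) ^ k
      \<le> exp (t * m) * exp (- (?u * (1 - exp (- t))))" by simp
  also have "\<dots> = exp (t * m - ?u * (1 - exp (- t)))"
    by (simp add: exp_add[symmetric])
  also have "t * m - ?u * (1 - exp (- t)) \<le> t * M - ?u * (t - t\<^sup>2 / 2)"
  proof (rule diff_mono)
    show "t * m \<le> t * M" using assms(3) t by (rule mult_left_mono)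
    show "?u * (t - t\<^sup>2 / 2) \<le> ?u * (1 - exp (- t))"
      using exp_minus_le_quadratic[OF t] assms(1) by (intro mult_left_mono) auto
  qed
  also have "\<dots> = - ((?u - M)\<^sup>2 / (2 * ?u))"
  proof (cases "?u = 0")
    case False
    then have "?u - M = t * ?u" by (simp add: t_def)
    then have M: "M = ?u - t * ?u" by simp
    show ?thesis
      unfolding \<open>?u - M = t * ?u\<close> using False
      by (subst M) (simp add: power2_eq_square field_simps)
  qed (auto simp: t_def)
  finally show "exp (t * m) * (1 - p * (1 - exp (- t))) ^ k
      \<le> exp (- ((?u - M)\<^sup>2 / (2 * real k * p)))" by (simp add: mult.assoc)
qed

section \<open>The mixing time bound\<close>

theorem theorem6p1:
  fixes n k :: nat and r :: "nat rel" and x :: "nat \<Rightarrow> real"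
    and \<mu> w :: "(nat \<Rightarrow> nat) pmf" and p :: real
  assumes forest: "rooted_forest {1..n} r"
    and labeled: "naturally_labeled r"
    and pos: "\<And>i. i \<in> {1..n} \<Longrightarrow> 0 < x i"
    and sum1: "(\<Sum>i\<in>{1..n}. x i) = 1"
    and p: "p = Min (x ` {1..n})"
    and init: "set_pmf \<mu> \<subseteq> linear_extensions n r"
    and stat: "stationary_dist (linear_extensions n r) (promotion_step n r x) w"
    and k: "real k \<ge> ((real n)\<^sup>2 - 1) / p"
  shows "tv_dist (linear_extensions n r) (chain_dist (promotion_step n r x) \<mu> k) w
    \<le> exp (- ((real k * p - ((real n)\<^sup>2 - 1))\<^sup>2 / (2 * real k * p)))"
proof -
  let ?L = "linear_extensions n r" and ?F = "promotion_by_label n r"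
  define X where "X = promotion_position n x id"
  have n: "1 \<le> n" using sum1 by (cases n) auto
  have po: "partial_order_on {1..n} r" using forest by (simp add: rooted_forest_def)
  have chain: "upward_linear r"
    unfolding upward_linear_def
    using upper_bounds_comparable[OF po labeled] rooted_forest_unique_cover[OF forest] by metis
  have pmf_X: "pmf X i = (if i \<in> {1..n} then x i else 0)" for i
    using pmf_promotion_position[of n x id i] pos sum1 permutes_id by (simp add: X_def)
  have set_X: "set_pmf X \<subseteq> {1..n}"
  proof
    fix i
    assume "i \<in> set_pmf X"
    then show "i \<in> {1..n}" using pmf_X[of i] by (metis set_pmf_iff)
  qed
  have p_le: "p \<le> pmf X i" if "i \<in> {1..n}" for i
    using that by (simp add: p pmf_X)
  have p_pos: "0 < p" using p pos n by (subst p, subst Min_gr_iff) auto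
  have p_1: "p \<le> 1" using p_le[of n] pmf_le_1[of X n] n by simp
  have step: "promotion_step n r x \<pi> = map_pmf (\<lambda>i. ?F i \<pi>) X" if "\<pi> \<in> ?L" for \<pi>
    using that promotion_step_by_label[of n x \<pi> r] pos sum1
    by (simp add: X_def linear_extensions_def)
  have stay: "?F i \<pi> \<in> ?L" if "\<pi> \<in> ?L" "i \<in> set_pmf X" for i \<pi>
    using that set_X promotion_by_label_linear_extensions[OF partial_order_onD(4)[OF po]] by blast
  have w: "set_pmf w \<subseteq> ?L" using stat by (simp add: stationary_dist_def)
  have coalesce: "fold ?F is \<pi> = fold ?F is \<sigma>"
    if "is \<in> set_pmf (replicate_pmf k X)" "is \<notin> {is. fold countdown is n \<noteq> 0}"
      "\<pi> \<in> set_pmf \<mu>" "\<sigma> \<in> set_pmf w" for "is" \<pi> \<sigma>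
    using that set_X init w
    by (intro fold_promotion_coalesces[OF po labeled chain]) (auto simp: set_replicate_pmf)
  have "tv_dist ?L (chain_dist (promotion_step n r x) \<mu> k) w
      = tv_dist ?L (chain_dist (promotion_step n r x) \<mu> k) (chain_dist (promotion_step n r x) w k)"
    using chain_dist_stationary[OF stat] by simp
  also have "\<dots> = tv_dist ?L (bind_pmf (replicate_pmf k X) (\<lambda>is. map_pmf (fold ?F is) \<mu>))
      (bind_pmf (replicate_pmf k X) (\<lambda>is. map_pmf (fold ?F is) w))"
    using chain_dist_random_maps[of ?L "promotion_step n r x" ?F X, OF step stay] init w by simp
  also have "\<dots> \<le> measure_pmf.prob (replicate_pmf k X) {is. fold countdown is n \<noteq> 0}"
    by (rule tv_dist_random_maps[OF finite_linear_extensions coalesce])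
  finally have tv: "tv_dist ?L (chain_dist (promotion_step n r x) \<mu> k) w
      \<le> measure_pmf.prob (replicate_pmf k X) {is. fold countdown is n \<noteq> 0}" .
  have "real n \<le> (real n)\<^sup>2" using n by (simp add: power2_eq_square)
  then have m: "real n - 1 \<le> (real n)\<^sup>2 - 1" by simp
  have kp: "(real n)\<^sup>2 - 1 \<le> real k * p" using k p_pos by (simp add: field_simps)
  note t = chernoff_exponent[OF less_imp_le[OF p_pos] p_1 m kp]
  have "n \<in> {1..n}" using n by simp
  from prob_countdown_unfinished[OF p_le t(1) this] show ?thesis
    using tv t(2) by (meson order.trans)
qed

end
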